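(* Let $\mathscr T=(V,E)$ be a rooted directed tree with root $\mathsf{root}$ and let $\mathscr T_\infty$ be the extended directed tree associated with $\mathscr T$, with vertex set $V_\infty=V\sqcup\{\infty\}$. For $u,b\in V$, consider a weight system $\lambda_u=\{\lambda_{uv}\}_{v\in V_\infty}$ of complex numbers and let $W^{(b)}_{\lambda_u}$ be the weighted join operator on $\mathscr T$. Then the following statements are equivalent: (i) $W^{(b)}_{\lambda_u}$ is normal. (ii) $W^{(b)}_{\lambda_u}$ is hyponormal. (iii) $W^{(b)}_{\lambda_u}$ is cohyponormal. (iv) $W^{(b)}_{\lambda_u}$ is diagonal with respect to the orthonormal basis $\{e_v\}_{v\in V}$. (v) $b=u$ or $\lambda_{uv}=0$ for every $v\in A_u\setminus\{u\}$, where $A_u=[u,b]$ if $b\in\mathsf{Des}(u)$ and $A_u=\mathsf{Asc}(u)\cup\{b,u\}$ otherwise.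
   Context: Trees. A directed tree $\mathscr T=(V,E)$ is a directed graph (no loops, $V$ and $E$ nonempty) which has no circuits, is connected (ignoring orientation), and in which every non-root vertex $v$ has exactly one parent $\mathsf{par}(v)$; it is rooted if there is a unique vertex $\mathsf{root}$ without parent. Throughout $\mathrm{card}(V)=\aleph_0$. $\mathsf{Des}(u)$ is the set of descendants of $u$, including $u$; $\mathsf{Asc}(u)=\{\mathsf{par}^{\langle n\rangle}(u):n\ge1\}$; depth is the length of the directed path from $\mathsf{root}$; for $v\in\mathsf{Des}(u)$, $[u,v]$ is the set of vertices of the directed path from $u$ to $v$. Join operations. The extended tree has vertex set $V_\infty=V\sqcup\{\infty\}$ with $\infty$ declared a child (hence a descendant) of every $v\in V$. For $u,v\in V_\infty$: $u\sqcup v=u$ if $u$ is a descendant of $v$; $=v$ if $v$ is a descendant of $u$; $=\infty$ otherwise. For $u,v\in V$, $u\sqcap v$ is the vertex of largest depth among $\{w\in V:\mathsf{par}^{\langle n\rangle}(u)=w=\mathsf{par}^{\langle m\rangle}(v)\text{ for some }m,n\ge0\}$. For $b\in V$: $u\sqcup_bv=u\sqcap v$ if $u,v\in\mathsf{Asc}(b)$; $=u$ if $v=b$; $=v$ if $u=b$; $=u\sqcup v$ otherwise. Operators. A weight system is a family $\{\lambda_{uv}\}_{v\in V_\infty}\subseteq\mathbb C$ with $\lambda_{u\infty}=0$. $W^{(b)}_{\lambda_u}$ is the operator in $\ell^2(V)$ with domain $\{f\in\ell^2(V):\Lambda^{(b)}_uf\in\ell^2(V)\}$ and $W^{(b)}_{\lambda_u}f=\Lambda^{(b)}_uf$,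 where $(\Lambda^{(b)}_uf)(w)=\sum_{v\in V:\,u\sqcup_bv=w}\lambda_{uv}f(v)$, $w\in V$. A densely defined operator $T$ is normal if $\mathscr D(T)=\mathscr D(T^* )$ and $\|T^*x\|=\|Tx\|$ for $x\in\mathscr D(T)$; hyponormal if $\mathscr D(T)\subseteq\mathscr D(T^* )$ and $\|T^*x\|\le\|Tx\|$ for $x\in\mathscr D(T)$; cohyponormal if $T$ is closed and $T^*$ is hyponormal. *)

theory Defs
  imports "HOL-Analysis.Analysis"
begin

section \<open>Rooted directed trees\<close>

text \<open>A directed graph is given by its vertex set and its edge relation; \<open>(x, y) \<in> E\<close> means
  that \<open>x\<close> is a parent of \<open>y\<close>. Absence of circuits is \<^const>\<open>acyclic\<close>.\<close>

locale directed_tree =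
  fixes V :: "'a set" and E :: "('a \<times> 'a) set"
  assumes vertices_nonempty: "V \<noteq> {}"
    and edges_nonempty: "E \<noteq> {}"
    and edges_subset: "E \<subseteq> V \<times> V"
    and no_loops: "irrefl E"
    and no_circuits: "acyclic E"
    and connected: "\<And>x y. x \<in> V \<Longrightarrow> y \<in> V \<Longrightarrow> (x, y) \<in> (E \<union> E\<inverse>)\<^sup>*"
    and unique_parent: "\<And>v. v \<in> V \<Longrightarrow> \<exists>p. (p, v) \<in> E \<Longrightarrow> \<exists>!p. (p, v) \<in> E"

locale rooted_directed_tree = directed_tree V E
  for V :: "'a set" and E :: "('a \<times> 'a) set" +
  assumes unique_root: "\<exists>!r. r \<in> V \<and> \<not> (\<exists>p. (p, r) \<in> E)"

definition root_of :: "'a set \<Rightarrow> ('a \<times> 'a) set \<Rightarrow> 'a" where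
  "root_of V E = (THE r. r \<in> V \<and> \<not> (\<exists>p. (p, r) \<in> E))"

text \<open>Since parents are unique, \<open>(w, v) \<in> E ^^ n\<close> says that the \<open>n\<close>-fold parent of \<open>v\<close> exists
  and equals \<open>w\<close>. This avoids giving a value to the parent of the root.\<close>

definition Asc :: "('a \<times> 'a) set \<Rightarrow> 'a \<Rightarrow> 'a set" where
  "Asc E v = {w. \<exists>n\<ge>1. (w, v) \<in> E ^^ n}"

definition Des :: "('a \<times> 'a) set \<Rightarrow> 'a \<Rightarrow> 'a set" where
  "Des E v = E\<^sup>* `` {v}"

definition depth :: "'a set \<Rightarrow> ('a \<times> 'a) set \<Rightarrow> 'a \<Rightarrow> nat" where
  "depth V E v = (THE n. (root_of V E, v) \<in> E ^^ n)"

definition directed_path :: "('a \<times> 'a) set \<Rightarrow> 'a \<Rightarrow> 'a list \<Rightarrow> 'a \<Rightarrow> bool" where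
  "directed_path E u xs v \<longleftrightarrow>
     xs \<noteq> [] \<and> hd xs = u \<and> last xs = v \<and> successively (\<lambda>x y. (x, y) \<in> E) xs"

text \<open>In a directed tree there is exactly one directed path from \<open>u\<close> to a descendant \<open>v\<close>, so the
  union over all directed paths below is the vertex set of that path.\<close>

definition segment :: "('a \<times> 'a) set \<Rightarrow> 'a \<Rightarrow> 'a \<Rightarrow> 'a set" where
  "segment E u v = {w. \<exists>xs. directed_path E u xs v \<and> w \<in> set xs}"


section \<open>The extended tree and the join operations\<close>

text \<open>The vertices of the extended tree are \<open>Some v\<close> for \<open>v \<in> V\<close> together with \<open>None\<close>,
  which plays the role of \<open>\<infinity>\<close>.\<close>

definition ext_edges :: "'a set \<Rightarrow> ('a \<times> 'a) set \<Rightarrow> ('a option \<times> 'a option) set" where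
  "ext_edges V E = {(Some x, Some y) |x y. (x, y) \<in> E} \<union> {(Some v, None) |v. v \<in> V}"

definition join :: "'a set \<Rightarrow> ('a \<times> 'a) set \<Rightarrow> 'a option \<Rightarrow> 'a option \<Rightarrow> 'a option" where
  "join V E x y =
     (if x \<in> Des (ext_edges V E) y then x
      else if y \<in> Des (ext_edges V E) x then y
      else None)"

definition common_ancestors :: "'a set \<Rightarrow> ('a \<times> 'a) set \<Rightarrow> 'a \<Rightarrow> 'a \<Rightarrow> 'a set" where
  "common_ancestors V E u v = {w \<in> V. \<exists>m n. (w, u) \<in> E ^^ n \<and> (w, v) \<in> E ^^ m}"

definition meet :: "'a set \<Rightarrow> ('a \<times> 'a) set \<Rightarrow> 'a \<Rightarrow> 'a \<Rightarrow> 'a" where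
  "meet V E u v =
     (THE w. w \<in> common_ancestors V E u v \<and>
        (\<forall>w' \<in> common_ancestors V E u v. depth V E w' \<le> depth V E w))"

definition join_at ::
    "'a set \<Rightarrow> ('a \<times> 'a) set \<Rightarrow> 'a \<Rightarrow> 'a option \<Rightarrow> 'a option \<Rightarrow> 'a option" where
  "join_at V E b x y =
     (if x \<in> Some ` Asc E b \<and> y \<in> Some ` Asc E b then Some (meet V E (the x) (the y))
      else if y = Some b then x
      else if x = Some b then y
      else join V E x y)"

definition A_set :: "('a \<times> 'a) set \<Rightarrow> 'a \<Rightarrow> 'a \<Rightarrow> 'a set" where
  "A_set E u b = (if b \<in> Des E u then segment E u b else Asc E u \<union> {b, u})"


section \<open>Unbounded operators in $\ell^2(V)$\<close>

text \<open>Elements of $\ell^2(V)$ are extended by zero outside \<open>V\<close>, so that equality in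
  $\ell^2(V)$ is equality of functions.\<close>

definition ell2 :: "'a set \<Rightarrow> ('a \<Rightarrow> complex) set" where
  "ell2 V = {f. (\<forall>v. v \<notin> V \<longrightarrow> f v = 0) \<and> (\<lambda>v. (cmod (f v))\<^sup>2) summable_on V}"

definition ell2_inner :: "'a set \<Rightarrow> ('a \<Rightarrow> complex) \<Rightarrow> ('a \<Rightarrow> complex) \<Rightarrow> complex" where
  "ell2_inner V f g = (\<Sum>\<^sub>\<infinity>v\<in>V. f v * cnj (g v))"

definition ell2_norm :: "'a set \<Rightarrow> ('a \<Rightarrow> complex) \<Rightarrow> real" where
  "ell2_norm V f = sqrt (\<Sum>\<^sub>\<infinity>v\<in>V. (cmod (f v))\<^sup>2)"

definition basis_vec :: "'a \<Rightarrow> 'a \<Rightarrow> complex" where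
  "basis_vec v = (\<lambda>w. if w = v then 1 else 0)"

text \<open>An operator consists of its domain and its action; the values of the action outside the
  domain are irrelevant.\<close>

datatype 'a ell2_operator =
  Ell2_Operator (op_dom: "('a \<Rightarrow> complex) set") (op_app: "('a \<Rightarrow> complex) \<Rightarrow> 'a \<Rightarrow> complex")

definition densely_defined :: "'a set \<Rightarrow> 'a ell2_operator \<Rightarrow> bool" where
  "densely_defined V T \<longleftrightarrow> op_dom T \<subseteq> ell2 V \<and>
     (\<forall>f \<in> ell2 V. \<forall>\<epsilon>>0. \<exists>g \<in> op_dom T. ell2_norm V (\<lambda>v. f v - g v) < \<epsilon>)"

definition closed_operator :: "'a set \<Rightarrow> 'a ell2_operator \<Rightarrow> bool" where
  "closed_operator V T \<longleftrightarrow>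
     (\<forall>F f g. (\<forall>n::nat. F n \<in> op_dom T) \<longrightarrow> f \<in> ell2 V \<longrightarrow> g \<in> ell2 V \<longrightarrow>
        (\<lambda>n. ell2_norm V (\<lambda>v. F n v - f v)) \<longlonglongrightarrow> 0 \<longrightarrow>
        (\<lambda>n. ell2_norm V (\<lambda>v. op_app T (F n) v - g v)) \<longlonglongrightarrow> 0 \<longrightarrow>
        f \<in> op_dom T \<and> op_app T f = g)"

text \<open>The adjoint is meaningful for densely defined operators only: then the vector \<open>h\<close> is
  unique.\<close>

definition adjoint_op :: "'a set \<Rightarrow> 'a ell2_operator \<Rightarrow> 'a ell2_operator" where
  "adjoint_op V T = Ell2_Operator
     {g \<in> ell2 V. \<exists>h \<in> ell2 V. \<forall>f \<in> op_dom T. ell2_inner V (op_app T f) g = ell2_inner V f h}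
     (\<lambda>g. THE h. h \<in> ell2 V \<and>
        (\<forall>f \<in> op_dom T. ell2_inner V (op_app T f) g = ell2_inner V f h))"

definition normal_op :: "'a set \<Rightarrow> 'a ell2_operator \<Rightarrow> bool" where
  "normal_op V T \<longleftrightarrow> densely_defined V T \<and>
     op_dom T = op_dom (adjoint_op V T) \<and>
     (\<forall>f \<in> op_dom T. ell2_norm V (op_app (adjoint_op V T) f) = ell2_norm V (op_app T f))"

definition hyponormal_op :: "'a set \<Rightarrow> 'a ell2_operator \<Rightarrow> bool" where
  "hyponormal_op V T \<longleftrightarrow> densely_defined V T \<and>
     op_dom T \<subseteq> op_dom (adjoint_op V T) \<and>
     (\<forall>f \<in> op_dom T. ell2_norm V (op_app (adjoint_op V T) f) \<le> ell2_norm V (op_app T f))"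

definition cohyponormal_op :: "'a set \<Rightarrow> 'a ell2_operator \<Rightarrow> bool" where
  "cohyponormal_op V T \<longleftrightarrow>
     densely_defined V T \<and> closed_operator V T \<and> hyponormal_op V (adjoint_op V T)"

text \<open>For an orthonormal basis \<open>e\<close> indexed by \<open>V\<close>, the operator is
  $f \mapsto \sum_v \mu_v \langle f, e_v\rangle e_v$ on its maximal domain; the sum is expressed
  through its Fourier coefficients.\<close>

definition diagonal_wrt ::
    "'a set \<Rightarrow> ('a \<Rightarrow> 'a \<Rightarrow> complex) \<Rightarrow> 'a ell2_operator \<Rightarrow> bool" where
  "diagonal_wrt V e T \<longleftrightarrow>
     (\<exists>\<mu> :: 'a \<Rightarrow> complex.
        op_dom T = {f \<in> ell2 V. (\<lambda>v. (cmod (\<mu> v * ell2_inner V f (e v)))\<^sup>2) summable_on V} \<and>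
        (\<forall>f \<in> op_dom T. op_app T f \<in> ell2 V \<and>
           (\<forall>v \<in> V. ell2_inner V (op_app T f) (e v) = \<mu> v * ell2_inner V f (e v))))"


section \<open>Weighted join operators\<close>

definition join_transform ::
    "'a set \<Rightarrow> ('a \<times> 'a) set \<Rightarrow> 'a \<Rightarrow> 'a \<Rightarrow> ('a option \<Rightarrow> complex) \<Rightarrow>
     ('a \<Rightarrow> complex) \<Rightarrow> 'a \<Rightarrow> complex" where
  "join_transform V E b u l f w =
     (if w \<in> V
      then \<Sum>\<^sub>\<infinity>v \<in> {v \<in> V. join_at V E b (Some u) (Some v) = Some w}. l (Some v) * f v
      else 0)"

definition weighted_join_op ::
    "'a set \<Rightarrow> ('a \<times> 'a) set \<Rightarrow> 'a \<Rightarrow> 'a \<Rightarrow> ('a option \<Rightarrow> complex) \<Rightarrow> 'a ell2_operator" where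
  "weighted_join_op V E b u l = Ell2_Operator
     {f \<in> ell2 V. join_transform V E b u l f \<in> ell2 V}
     (join_transform V E b u l)"

end

theory Submission
  imports Defs
begin

text \<open>For \<open>b = u\<close> the map \<open>v \<mapsto> u \<squnion>\<^sub>b v\<close> is the identity, so the operator multiplies each
  coordinate by its weight. For \<open>b \<noteq> u\<close> the map collapses exactly the set \<open>A\<^sub>u\<close> to \<open>u\<close>,
  and every other vertex is either fixed or sent to \<open>\<infinity>\<close> (\<open>join_at_cases\<close>). In a rooted tree
  \<open>A\<^sub>u\<close> is finite, because every vertex has finitely many ancestors. As a matrix, the operator is
  therefore diagonal apart from one finitely supported row, the row of \<open>u\<close>, whose entries are the
  weights on \<open>A\<^sub>u\<close>; and its diagonal vanishes at the other points of \<open>A\<^sub>u\<close>.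
  From here on the tree can be forgotten.

  If the row has no entry off the diagonal, the operator is multiplication by a function on its
  maximal domain. The adjoint is then multiplication by the conjugate function, and normality,
  closedness, cohyponormality and diagonality follow.

  Suppose now that the row has an entry \<open>c a \<noteq> 0\<close> with \<open>a \<noteq> u\<close>. Column \<open>a\<close> has \<open>c a\<close> in row \<open>u\<close>
  as its only nonzero entry, so \<open>T e\<^sub>a = c a e\<^sub>u\<close> is orthogonal to \<open>e\<^sub>a\<close> and \<open>T\<close> is not diagonal.
  The vector \<open>e\<^sub>u - (c u / c a) e\<^sub>a\<close> lies in the kernel of \<open>T\<close> but not in the kernel of the adjoint,
  which contradicts hyponormality; and \<open>e\<^sub>a\<close> lies in the kernel of the adjoint but not in that of
  the second adjoint, which contradicts cohyponormality. Both computations only read off single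
  matrix coefficients, so unboundedness of \<open>T\<close> causes no trouble.\<close>

section \<open>Vectors of finite support and coordinates\<close>

lemma ell2_inner_finite_support:
  assumes "finite F" "F \<subseteq> V" "\<And>v. v \<in> V \<Longrightarrow> v \<notin> F \<Longrightarrow> f v * cnj (g v) = 0"
  shows "ell2_inner V f g = (\<Sum>v\<in>F. f v * cnj (g v))"
proof -
  have "ell2_inner V f g = (\<Sum>\<^sub>\<infinity>v\<in>F. f v * cnj (g v))"
    unfolding ell2_inner_def by (rule infsum_cong_neutral) (use assms in auto)
  then show ?thesis using assms(1) by simp
qed

lemma ell2_inner_basis_right:
  assumes "v \<in> V"
  shows "ell2_inner V f (basis_vec v) = f v"
  using assms ell2_inner_finite_support[of "{v}" V f "basis_vec v"] by (simp add: basis_vec_def)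

lemma ell2_inner_basis_left:
  assumes "v \<in> V"
  shows "ell2_inner V (basis_vec v) g = cnj (g v)"
  using assms ell2_inner_finite_support[of "{v}" V "basis_vec v" g] by (simp add: basis_vec_def)

lemma finite_support_in_ell2:
  assumes "finite F" "F \<subseteq> V" "\<And>v. v \<notin> F \<Longrightarrow> f v = 0"
  shows "f \<in> ell2 V"
proof -
  have "(\<lambda>v. (cmod (f v))\<^sup>2) summable_on F" using assms(1) by simp
  then have "(\<lambda>v. (cmod (f v))\<^sup>2) summable_on V"
    by (rule summable_on_cong_neutral[THEN iffD1, rotated -1]) (use assms in auto)
  then show ?thesis using assms by (auto simp: ell2_def)
qed

lemma basis_vec_in_ell2: "v \<in> V \<Longrightarrow> basis_vec v \<in> ell2 V"
  by (rule finite_support_in_ell2[of "{v}"]) (auto simp: basis_vec_def)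

lemma ell2_diff:
  assumes "f \<in> ell2 V" "g \<in> ell2 V"
  shows "(\<lambda>v. f v - g v) \<in> ell2 V"
proof -
  have "(\<lambda>v. (cmod (f v - g v))\<^sup>2) summable_on V"
  proof (rule summable_on_comparison_test)
    show "(\<lambda>v. 2 * (cmod (f v))\<^sup>2 + 2 * (cmod (g v))\<^sup>2) summable_on V"
      using assms by (auto simp: ell2_def intro!: summable_on_add summable_on_cmult_right)
    fix v
    have "(cmod (f v - g v))\<^sup>2 \<le> (cmod (f v) + cmod (g v))\<^sup>2"
      by (intro power_mono norm_triangle_ineq4) auto
    also have "\<dots> \<le> 2 * (cmod (f v))\<^sup>2 + 2 * (cmod (g v))\<^sup>2"
      using sum_squares_bound[of "cmod (f v)" "cmod (g v)"] by (simp add: power2_sum)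
    finally show "(cmod (f v - g v))\<^sup>2 \<le> 2 * (cmod (f v))\<^sup>2 + 2 * (cmod (g v))\<^sup>2" .
  qed auto
  then show ?thesis using assms by (auto simp: ell2_def)
qed

lemma coordinate_le_ell2_norm:
  assumes "f \<in> ell2 V" "v \<in> V"
  shows "cmod (f v) \<le> ell2_norm V f"
proof -
  have "(\<Sum>\<^sub>\<infinity>w\<in>{v}. (cmod (f w))\<^sup>2) \<le> (\<Sum>\<^sub>\<infinity>w\<in>V. (cmod (f w))\<^sup>2)"
    by (rule infsum_mono_neutral) (use assms in \<open>auto simp: ell2_def\<close>)
  then show ?thesis unfolding ell2_norm_def by (intro real_le_rsqrt) simp
qed

lemma ell2_norm_zero: "(\<And>v. v \<in> V \<Longrightarrow> f v = 0) \<Longrightarrow> ell2_norm V f = 0"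
  unfolding ell2_norm_def by (subst infsum_0) auto

lemma ell2_tendsto_coordinate:
  assumes "\<And>n. F n \<in> ell2 V" "f \<in> ell2 V" "v \<in> V"
    and "(\<lambda>n::nat. ell2_norm V (\<lambda>v. F n v - f v)) \<longlonglongrightarrow> 0"
  shows "(\<lambda>n. F n v) \<longlonglongrightarrow> f v"
proof -
  have "(\<lambda>n. F n v - f v) \<longlonglongrightarrow> 0"
    by (rule Lim_null_comparison[OF _ assms(4)])
      (use coordinate_le_ell2_norm[OF ell2_diff[OF assms(1,2)] assms(3)] in auto)
  then show ?thesis by (simp add: LIM_zero_iff)
qed

text \<open>This is the density of the finitely supported vectors.\<close>

lemma ell2_truncation:
  assumes "f \<in> ell2 V" "\<epsilon> > 0"
  obtains F where "finite F" "F \<subseteq> V" "ell2_norm V (\<lambda>v. f v - (if v \<in> F then f v else 0)) < \<epsilon>"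
proof -
  let ?q = "\<lambda>v. (cmod (f v))\<^sup>2"
  have s: "?q summable_on V" using assms by (simp add: ell2_def)
  have "\<forall>\<^sub>F F in finite_subsets_at_top V. dist (sum ?q F) (infsum ?q V) < \<epsilon>\<^sup>2"
    using infsum_tendsto[OF s] assms(2) by (auto simp: tendsto_iff)
  then obtain F where F: "finite F" "F \<subseteq> V" "dist (sum ?q F) (infsum ?q V) < \<epsilon>\<^sup>2"
    unfolding eventually_finite_subsets_at_top by blast
  have "(\<Sum>\<^sub>\<infinity>v\<in>V. (cmod (f v - (if v \<in> F then f v else 0)))\<^sup>2) = infsum ?q (V - F)"
    by (rule infsum_cong_neutral) auto
  also have "\<dots> = infsum ?q V - infsum ?q F"
    by (rule infsum_Diff) (use s F in auto)
  also have "\<dots> < \<epsilon>\<^sup>2" using F by (simp add: dist_real_def)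
  finally have "ell2_norm V (\<lambda>v. f v - (if v \<in> F then f v else 0)) < \<epsilon>"
    unfolding ell2_norm_def using assms(2) real_sqrt_less_mono by fastforce
  with F(1,2) show ?thesis by (rule that)
qed

section \<open>Adjoints of operators whose domain contains the basis\<close>

text \<open>A vector \<open>h\<close> is determined by its inner products with the basis vectors. If these belong
  to the domain, the definite description in the definition of the adjoint is unambiguous.\<close>

lemma adjoint_app_eq:
  assumes basis: "\<And>v. v \<in> V \<Longrightarrow> basis_vec v \<in> op_dom T"
    and h: "h \<in> ell2 V" "\<And>f. f \<in> op_dom T \<Longrightarrow> ell2_inner V (op_app T f) g = ell2_inner V f h"
  shows "op_app (adjoint_op V T) g = h"
proof -
  have "k = h" if "k \<in> ell2 V"
    "\<forall>f \<in> op_dom T. ell2_inner V (op_app T f) g = ell2_inner V f k" for k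
  proof
    fix v show "k v = h v"
    proof (cases "v \<in> V")
      case True
      then have "ell2_inner V (basis_vec v) k = ell2_inner V (basis_vec v) h"
        using that(2) h(2) basis by metis
      then show ?thesis using True by (simp add: ell2_inner_basis_left)
    qed (use that(1) h(1) in \<open>auto simp: ell2_def\<close>)
  qed
  then show ?thesis
    unfolding adjoint_op_def by (auto intro!: the_equality h)
qed

lemma adjoint_domI:
  assumes "g \<in> ell2 V" "h \<in> ell2 V"
    and "\<And>f. f \<in> op_dom T \<Longrightarrow> ell2_inner V (op_app T f) g = ell2_inner V f h"
  shows "g \<in> op_dom (adjoint_op V T)"
  using assms by (auto simp: adjoint_op_def)

text \<open>Testing the defining identity of the adjoint on a basis vector shows that the adjoint is
  given by the conjugate transpose of the matrix of \<open>T\<close>.\<close>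

lemma adjoint_coordinate:
  assumes basis: "\<And>v. v \<in> V \<Longrightarrow> basis_vec v \<in> op_dom T"
    and g: "g \<in> op_dom (adjoint_op V T)"
  shows "v \<in> V \<Longrightarrow> op_app (adjoint_op V T) g v = cnj (ell2_inner V (op_app T (basis_vec v)) g)"
    and "op_app (adjoint_op V T) g \<in> ell2 V"
proof -
  obtain h where h: "h \<in> ell2 V"
    "\<And>f. f \<in> op_dom T \<Longrightarrow> ell2_inner V (op_app T f) g = ell2_inner V f h"
    using g by (auto simp: adjoint_op_def)
  have eq: "op_app (adjoint_op V T) g = h" by (rule adjoint_app_eq[OF basis h])
  show "op_app (adjoint_op V T) g \<in> ell2 V" using eq h by simp
  show "op_app (adjoint_op V T) g v = cnj (ell2_inner V (op_app T (basis_vec v)) g)"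
    if v: "v \<in> V" using h(2)[OF basis[OF v]] eq v by (simp add: ell2_inner_basis_left)
qed

section \<open>Multiplication operators\<close>

text \<open>The action is prescribed on the domain only. An adjoint takes unspecified values elsewhere,
  so in this form the notion applies to adjoints as well.\<close>

definition multiplication_op :: "'a set \<Rightarrow> ('a \<Rightarrow> complex) \<Rightarrow> 'a ell2_operator \<Rightarrow> bool" where
  "multiplication_op V \<mu> T \<longleftrightarrow>
     op_dom T = {f \<in> ell2 V. (\<lambda>v. \<mu> v * f v) \<in> ell2 V} \<and>
     (\<forall>f \<in> op_dom T. op_app T f = (\<lambda>v. \<mu> v * f v))"

lemma multiplication_op_finite_support_in_dom:
  assumes "multiplication_op V \<mu> T" "finite F" "F \<subseteq> V" "\<And>v. v \<notin> F \<Longrightarrow> f v = 0"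
  shows "f \<in> op_dom T"
  using assms finite_support_in_ell2[of F V f] finite_support_in_ell2[of F V "\<lambda>v. \<mu> v * f v"]
  by (auto simp: multiplication_op_def)

lemma multiplication_op_basis_in_dom:
  assumes "multiplication_op V \<mu> T" "v \<in> V"
  shows "basis_vec v \<in> op_dom T"
  by (rule multiplication_op_finite_support_in_dom[OF assms(1), of "{v}"])
    (use assms(2) in \<open>auto simp: basis_vec_def\<close>)

lemma multiplication_op_densely_defined:
  assumes "multiplication_op V \<mu> T"
  shows "densely_defined V T"
  unfolding densely_defined_def
proof (intro conjI ballI allI impI)
  show "op_dom T \<subseteq> ell2 V" using assms by (auto simp: multiplication_op_def)
  fix f :: "'a \<Rightarrow> complex" and \<epsilon> :: real
  assume "f \<in> ell2 V" "\<epsilon> > 0"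
  then obtain F where F: "finite F" "F \<subseteq> V"
    "ell2_norm V (\<lambda>v. f v - (if v \<in> F then f v else 0)) < \<epsilon>" by (rule ell2_truncation)
  show "\<exists>g\<in>op_dom T. ell2_norm V (\<lambda>v. f v - g v) < \<epsilon>"
  proof (rule bexI)
    show "ell2_norm V (\<lambda>v. f v - (if v \<in> F then f v else 0)) < \<epsilon>" by (rule F(3))
    show "(\<lambda>v. if v \<in> F then f v else 0) \<in> op_dom T"
      by (rule multiplication_op_finite_support_in_dom[OF assms F(1,2)]) auto
  qed
qed

lemma in_ell2_cong_cmod:
  assumes "\<And>v. cmod (f v) = cmod (g v)"
  shows "f \<in> ell2 V \<longleftrightarrow> g \<in> ell2 V"
proof -
  have "f v = 0 \<longleftrightarrow> g v = 0" for v using assms[of v] by (metis norm_eq_zero)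
  then show ?thesis by (simp add: ell2_def assms)
qed

text \<open>If \<open>g\<close> is in the domain of the adjoint, its image has the coordinates of
  \<open>cnj \<mu> \<cdot> g\<close>, which puts this product into \<open>\<ell>\<^sup>2\<close>. Conversely,
  \<open>\<langle>\<mu> f, g\<rangle> = \<langle>f, cnj \<mu> g\<rangle>\<close> holds term by term.\<close>

lemma multiplication_op_adjoint:
  assumes T: "multiplication_op V \<mu> T"
  shows "multiplication_op V (\<lambda>v. cnj (\<mu> v)) (adjoint_op V T)"
proof -
  note basis = multiplication_op_basis_in_dom[OF T]
  have dom_sub: "g \<in> ell2 V \<and> op_app (adjoint_op V T) g = (\<lambda>v. cnj (\<mu> v) * g v)
      \<and> (\<lambda>v. cnj (\<mu> v) * g v) \<in> ell2 V"
    if g: "g \<in> op_dom (adjoint_op V T)" for g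
  proof -
    have g2: "g \<in> ell2 V" using g by (simp add: adjoint_op_def)
    have h2: "op_app (adjoint_op V T) g \<in> ell2 V" by (rule adjoint_coordinate(2)[OF basis g])
    have "op_app (adjoint_op V T) g v = cnj (\<mu> v) * g v" for v
    proof (cases "v \<in> V")
      case True
      have "op_app T (basis_vec v) = (\<lambda>w. \<mu> w * basis_vec v w)"
        using T basis[OF True] by (auto simp: multiplication_op_def)
      then have "ell2_inner V (op_app T (basis_vec v)) g = \<mu> v * cnj (g v)"
        using True ell2_inner_finite_support[of "{v}" V "\<lambda>w. \<mu> w * basis_vec v w" g]
        by (simp add: basis_vec_def)
      then show ?thesis using adjoint_coordinate(1)[OF basis g True] by simp
    qed (use g2 h2 in \<open>auto simp: ell2_def\<close>)
    then have "op_app (adjoint_op V T) g = (\<lambda>v. cnj (\<mu> v) * g v)" by blast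
    with g2 h2 show ?thesis by simp
  qed
  have "g \<in> op_dom (adjoint_op V T)" if "g \<in> ell2 V" "(\<lambda>v. cnj (\<mu> v) * g v) \<in> ell2 V" for g
    using that T
    by (intro adjoint_domI[OF that])
      (auto simp: ell2_inner_def multiplication_op_def mult_ac)
  then show ?thesis using dom_sub by (auto simp: multiplication_op_def)
qed

lemma multiplication_op_normal:
  assumes T: "multiplication_op V \<mu> T"
  shows "normal_op V T"
proof -
  note A = multiplication_op_adjoint[OF T]
  have "(\<lambda>v. cnj (\<mu> v) * f v) \<in> ell2 V \<longleftrightarrow> (\<lambda>v. \<mu> v * f v) \<in> ell2 V" for f
    by (rule in_ell2_cong_cmod) (simp add: norm_mult)
  then have dom: "op_dom T = op_dom (adjoint_op V T)"
    using T A by (auto simp: multiplication_op_def)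
  have "ell2_norm V (op_app (adjoint_op V T) f) = ell2_norm V (op_app T f)"
    if "f \<in> op_dom T" for f
  proof -
    have "op_app T f = (\<lambda>v. \<mu> v * f v)" using T that by (auto simp: multiplication_op_def)
    moreover have "op_app (adjoint_op V T) f = (\<lambda>v. cnj (\<mu> v) * f v)"
      using A that dom by (auto simp: multiplication_op_def)
    ultimately show ?thesis by (simp add: ell2_norm_def norm_mult)
  qed
  with dom show ?thesis
    using multiplication_op_densely_defined[OF T] by (simp add: normal_op_def)
qed

lemma normal_imp_hyponormal: "normal_op V T \<Longrightarrow> hyponormal_op V T"
  by (auto simp: normal_op_def hyponormal_op_def)

text \<open>Norm convergence implies convergence of each coordinate, and the relation \<open>g = \<mu> f\<close> can be
  checked coordinatewise.\<close>

lemma multiplication_op_closed: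
  assumes T: "multiplication_op V \<mu> T"
  shows "closed_operator V T"
  unfolding closed_operator_def
proof (intro allI impI)
  fix F :: "nat \<Rightarrow> 'a \<Rightarrow> complex" and f g
  assume F: "\<forall>n. F n \<in> op_dom T" and f: "f \<in> ell2 V" and g: "g \<in> ell2 V"
    and lim: "(\<lambda>n. ell2_norm V (\<lambda>v. F n v - f v)) \<longlonglongrightarrow> 0"
    and lim': "(\<lambda>n. ell2_norm V (\<lambda>v. op_app T (F n) v - g v)) \<longlonglongrightarrow> 0"
  have TF: "op_app T (F n) = (\<lambda>v. \<mu> v * F n v)" for n
    using F T by (auto simp: multiplication_op_def)
  have F2: "F n \<in> ell2 V" and TF2: "op_app T (F n) \<in> ell2 V" for n
    using F T TF by (auto simp: multiplication_op_def)
  have "\<mu> v * f v = g v" for v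
  proof (cases "v \<in> V")
    case True
    have "(\<lambda>n. \<mu> v * F n v) \<longlonglongrightarrow> \<mu> v * f v"
      by (intro tendsto_mult tendsto_const ell2_tendsto_coordinate[OF F2 f True lim])
    moreover have "(\<lambda>n. \<mu> v * F n v) \<longlonglongrightarrow> g v"
      using ell2_tendsto_coordinate[OF TF2 g True lim'] by (simp add: TF)
    ultimately show ?thesis by (rule LIMSEQ_unique)
  qed (use f g in \<open>auto simp: ell2_def\<close>)
  then have eq: "(\<lambda>v. \<mu> v * f v) = g" by blast
  with f g have "f \<in> op_dom T" using T by (auto simp: multiplication_op_def)
  with eq show "f \<in> op_dom T \<and> op_app T f = g" using T by (auto simp: multiplication_op_def)
qed

lemma multiplication_op_cohyponormal:
  assumes "multiplication_op V \<mu> T"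
  shows "cohyponormal_op V T"
  unfolding cohyponormal_op_def
  using multiplication_op_densely_defined[OF assms] multiplication_op_closed[OF assms]
    normal_imp_hyponormal[OF multiplication_op_normal[OF multiplication_op_adjoint[OF assms]]]
  by simp

lemma multiplication_op_diagonal:
  assumes T: "multiplication_op V \<mu> T"
  shows "diagonal_wrt V basis_vec T"
proof -
  have "(\<lambda>v. \<mu> v * f v) \<in> ell2 V \<longleftrightarrow>
      (\<lambda>v. (cmod (\<mu> v * ell2_inner V f (basis_vec v)))\<^sup>2) summable_on V" if "f \<in> ell2 V" for f
  proof -
    have "(\<lambda>v. (cmod (\<mu> v * ell2_inner V f (basis_vec v)))\<^sup>2) summable_on V \<longleftrightarrow>
        (\<lambda>v. (cmod (\<mu> v * f v))\<^sup>2) summable_on V"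
      by (rule summable_on_cong) (simp add: ell2_inner_basis_right)
    then show ?thesis using that by (auto simp: ell2_def)
  qed
  then show ?thesis
    unfolding diagonal_wrt_def using T
    by (intro exI[of _ \<mu>]) (auto simp: multiplication_op_def ell2_inner_basis_right)
qed

section \<open>Diagonal operators with one additional row\<close>

text \<open>The diagonal matrix with entries \<open>\<mu>\<close> has its row \<open>u\<close> replaced by the finitely supported row
  \<open>c\<close>. Since \<open>\<mu>\<close> vanishes on the support set \<open>A\<close>, a column indexed by \<open>A\<close> meets no row other
  than \<open>u\<close>.\<close>

locale row_perturbed_diagonal =
  fixes V A :: "'a set" and u :: 'a and c \<mu> :: "'a \<Rightarrow> complex" and T :: "'a ell2_operator"
  assumes finite_row: "finite A" and row_subset: "A \<subseteq> V" and u_in_row: "u \<in> A"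
    and vanishing: "\<And>a. a \<in> A \<Longrightarrow> \<mu> a = 0"
    and dom_eq: "op_dom T = {f \<in> ell2 V. op_app T f \<in> ell2 V}"
    and app_eq: "\<And>f. f \<in> ell2 V \<Longrightarrow>
       op_app T f = (\<lambda>w. if w = u then \<Sum>v\<in>A. c v * f v else \<mu> w * f w)"
begin

lemma u_in_V: "u \<in> V" using row_subset u_in_row by blast

lemma finite_support_in_dom:
  assumes F: "finite F" "F \<subseteq> V" "\<And>v. v \<notin> F \<Longrightarrow> f v = 0"
  shows "f \<in> op_dom T"
proof -
  have f: "f \<in> ell2 V" by (rule finite_support_in_ell2[OF F])
  moreover have "op_app T f \<in> ell2 V"
    unfolding app_eq[OF f]
    by (rule finite_support_in_ell2[of "insert u F"]) (use F u_in_V in auto)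
  ultimately show ?thesis by (simp add: dom_eq)
qed

lemma basis_in_dom: "v \<in> V \<Longrightarrow> basis_vec v \<in> op_dom T"
  by (rule finite_support_in_dom[of "{v}"]) (auto simp: basis_vec_def)

lemma app_basis_row:
  assumes "a \<in> A" "a \<noteq> u"
  shows "op_app T (basis_vec a) = (\<lambda>w. c a * basis_vec u w)"
proof -
  have "(\<Sum>v\<in>A. c v * basis_vec a v) = c a"
    using assms finite_row by (simp add: basis_vec_def if_distrib cong: if_cong)
  moreover have "basis_vec a \<in> ell2 V" using assms row_subset by (auto intro: basis_vec_in_ell2)
  ultimately show ?thesis
    using assms by (auto simp: app_eq basis_vec_def vanishing fun_eq_iff)
qed

lemma multiplication_if_row_trivial:
  assumes "\<forall>a\<in>A - {u}. c a = 0"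
  shows "multiplication_op V (\<mu>(u := c u)) T"
proof -
  have "op_app T f = (\<lambda>w. (\<mu>(u := c u)) w * f w)" if "f \<in> ell2 V" for f
  proof -
    have "(\<Sum>v\<in>A. c v * f v) = (\<Sum>v\<in>{u}. c v * f v)"
      by (rule sum.mono_neutral_right) (use assms finite_row u_in_row in auto)
    then show ?thesis using that by (auto simp: app_eq fun_eq_iff)
  qed
  then show ?thesis by (auto simp: multiplication_op_def dom_eq)
qed

text \<open>A hyponormal operator satisfies \<open>ker T \<subseteq> ker T\<^sup>*\<close>. Two columns that are multiples of
  \<open>e\<^sub>u\<close> have a linear combination in \<open>ker T\<close>; its \<open>u\<close>-coordinate is \<open>1\<close>, so its image under the
  adjoint has the coordinate \<open>cnj (c a)\<close> at \<open>a\<close>.\<close>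

lemma hyponormal_imp_row_trivial:
  assumes hyp: "hyponormal_op V T"
  shows "\<forall>a\<in>A - {u}. c a = 0"
proof (rule ccontr)
  assume "\<not> ?thesis"
  then obtain a where a: "a \<in> A" "a \<noteq> u" "c a \<noteq> 0" by blast
  have aV: "a \<in> V" using a row_subset by blast
  define f where "f = (\<lambda>v. if v = u then 1 else if v = a then - (c u / c a) else 0)"
  have f: "f \<in> op_dom T"
    by (rule finite_support_in_dom[of "{u, a}"]) (use aV u_in_V in \<open>auto simp: f_def\<close>)
  then have f2: "f \<in> ell2 V" by (simp add: dom_eq)
  have "(\<Sum>v\<in>A. c v * f v) = (\<Sum>v\<in>{u, a}. c v * f v)"
    by (rule sum.mono_neutral_right) (use a finite_row u_in_row in \<open>auto simp: f_def\<close>)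
  also have "\<dots> = 0" using a by (simp add: f_def)
  finally have "op_app T f = (\<lambda>w. 0)"
    using a u_in_row by (auto simp: app_eq[OF f2] fun_eq_iff) (auto simp: f_def vanishing split: if_splits)
  then have "ell2_norm V (op_app T f) = 0" by (simp add: ell2_norm_zero)
  moreover have fadj: "f \<in> op_dom (adjoint_op V T)"
    using hyp f by (auto simp: hyponormal_op_def)
  moreover have "cmod (op_app (adjoint_op V T) f a) \<le> ell2_norm V (op_app (adjoint_op V T) f)"
    by (rule coordinate_le_ell2_norm[OF adjoint_coordinate(2)[OF basis_in_dom fadj] aV])
  moreover have "ell2_norm V (op_app (adjoint_op V T) f) \<le> ell2_norm V (op_app T f)"
    using hyp f by (auto simp: hyponormal_op_def)
  moreover have "op_app (adjoint_op V T) f a = cnj (c a)"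
  proof -
    have "ell2_inner V (op_app T (basis_vec a)) f = c a"
      unfolding app_basis_row[OF a(1,2)]
      using ell2_inner_finite_support[of "{u}" V "\<lambda>w. c a * basis_vec u w" f] u_in_V
      by (simp add: basis_vec_def f_def)
    then show ?thesis using adjoint_coordinate(1)[OF basis_in_dom fadj aV] by simp
  qed
  ultimately have "cmod (cnj (c a)) \<le> 0" by (metis order.trans)
  then show False using a(3) by simp
qed

text \<open>Every basis vector belongs to the domain of the adjoint, since every row of the matrix has
  finite support. This makes the second adjoint accessible through \<open>adjoint_coordinate\<close>.\<close>

lemma adjoint_basis_row:
  shows "basis_vec u \<in> op_dom (adjoint_op V T)"
    and "op_app (adjoint_op V T) (basis_vec u) = (\<lambda>v. if v \<in> A then cnj (c v) else 0)"
proof -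
  let ?h = "\<lambda>v. if v \<in> A then cnj (c v) else 0"
  have h: "?h \<in> ell2 V"
    by (rule finite_support_in_ell2[OF finite_row row_subset]) auto
  have eq: "ell2_inner V (op_app T f) (basis_vec u) = ell2_inner V f ?h" if "f \<in> op_dom T" for f
  proof -
    have "ell2_inner V f ?h = (\<Sum>v\<in>A. f v * c v)"
      using ell2_inner_finite_support[OF finite_row row_subset, of f ?h] by simp
    then show ?thesis using that
      by (simp add: ell2_inner_basis_right[OF u_in_V] dom_eq app_eq mult.commute)
  qed
  show "basis_vec u \<in> op_dom (adjoint_op V T)"
    by (rule adjoint_domI[OF basis_vec_in_ell2[OF u_in_V] h eq])
  show "op_app (adjoint_op V T) (basis_vec u) = ?h"
    by (rule adjoint_app_eq[OF basis_in_dom h eq])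
qed

lemma adjoint_basis_other:
  assumes v: "v \<in> V" "v \<noteq> u"
  shows "basis_vec v \<in> op_dom (adjoint_op V T)"
    and "op_app (adjoint_op V T) (basis_vec v) = (\<lambda>w. cnj (\<mu> v) * basis_vec v w)"
proof -
  let ?h = "\<lambda>w. cnj (\<mu> v) * basis_vec v w"
  have h: "?h \<in> ell2 V"
    by (rule finite_support_in_ell2[of "{v}"]) (use v in \<open>auto simp: basis_vec_def\<close>)
  have eq: "ell2_inner V (op_app T f) (basis_vec v) = ell2_inner V f ?h" if "f \<in> op_dom T" for f
  proof -
    have "ell2_inner V f ?h = f v * \<mu> v"
      using ell2_inner_finite_support[of "{v}" V f ?h] v by (simp add: basis_vec_def)
    then show ?thesis using that v
      by (simp add: ell2_inner_basis_right dom_eq app_eq mult.commute)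
  qed
  show "basis_vec v \<in> op_dom (adjoint_op V T)"
    by (rule adjoint_domI[OF basis_vec_in_ell2[OF v(1)] h eq])
  show "op_app (adjoint_op V T) (basis_vec v) = ?h"
    by (rule adjoint_app_eq[OF basis_in_dom h eq])
qed

text \<open>Here hyponormality of the adjoint is tested on \<open>e\<^sub>a\<close>, which the adjoint annihilates because
  row \<open>a\<close> is zero, whereas the second adjoint again has the coefficient \<open>c a\<close> in row \<open>u\<close>.\<close>

lemma cohyponormal_imp_row_trivial:
  assumes coh: "cohyponormal_op V T"
  shows "\<forall>a\<in>A - {u}. c a = 0"
proof
  fix a assume "a \<in> A - {u}"
  then have a: "a \<in> A" "a \<noteq> u" "a \<in> V" using row_subset by auto
  let ?S = "adjoint_op V T"
  have hyp: "hyponormal_op V ?S" using coh by (simp add: cohyponormal_op_def)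
  have basis: "basis_vec v \<in> op_dom ?S" if "v \<in> V" for v
    using adjoint_basis_row(1) adjoint_basis_other(1) that by blast
  have ea: "basis_vec a \<in> op_dom (adjoint_op V ?S)"
    using hyp basis[OF a(3)] by (auto simp: hyponormal_op_def)
  have "ell2_norm V (op_app ?S (basis_vec a)) = 0"
    by (rule ell2_norm_zero) (simp add: adjoint_basis_other[OF a(3,2)] vanishing a)
  moreover have "ell2_norm V (op_app (adjoint_op V ?S) (basis_vec a))
      \<le> ell2_norm V (op_app ?S (basis_vec a))"
    using hyp basis[OF a(3)] by (auto simp: hyponormal_op_def)
  moreover have "cmod (op_app (adjoint_op V ?S) (basis_vec a) u)
      \<le> ell2_norm V (op_app (adjoint_op V ?S) (basis_vec a))"
    by (rule coordinate_le_ell2_norm[OF adjoint_coordinate(2)[OF basis ea] u_in_V])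
  moreover have "op_app (adjoint_op V ?S) (basis_vec a) u = c a"
    using adjoint_coordinate(1)[OF basis ea u_in_V] a
    by (simp add: ell2_inner_basis_right adjoint_basis_row(2))
  ultimately have "cmod (c a) \<le> 0" by (metis order.trans)
  then show "c a = 0" by simp
qed

lemma diagonal_imp_row_trivial:
  assumes "diagonal_wrt V basis_vec T"
  shows "\<forall>a\<in>A - {u}. c a = 0"
proof
  fix a assume "a \<in> A - {u}"
  then have a: "a \<in> A" "a \<noteq> u" "a \<in> V" using row_subset by auto
  obtain \<nu> where "\<forall>f\<in>op_dom T. \<forall>v\<in>V.
      ell2_inner V (op_app T f) (basis_vec v) = \<nu> v * ell2_inner V f (basis_vec v)"
    using assms by (auto simp: diagonal_wrt_def)
  then have "ell2_inner V (op_app T (basis_vec a)) (basis_vec u)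
      = \<nu> u * ell2_inner V (basis_vec a) (basis_vec u)"
    using basis_in_dom[OF a(3)] u_in_V by blast
  then show "c a = 0"
    using a(2) unfolding ell2_inner_basis_right[OF u_in_V] app_basis_row[OF a(1,2)]
    by (simp add: basis_vec_def)
qed

end

section \<open>Ancestors in a rooted directed tree\<close>

lemma Asc_iff: "w \<in> Asc E v \<longleftrightarrow> (w, v) \<in> E\<^sup>+"
  by (auto simp: Asc_def trancl_power Suc_le_eq)

lemma Des_iff: "w \<in> Des E v \<longleftrightarrow> (v, w) \<in> E\<^sup>*"
  by (simp add: Des_def)

lemma segment_iff: "w \<in> segment E u v \<longleftrightarrow> (u, w) \<in> E\<^sup>* \<and> (w, v) \<in> E\<^sup>*"
proof
  have reach: "\<forall>w \<in> set xs. (hd xs, w) \<in> E\<^sup>* \<and> (w, last xs) \<in> E\<^sup>*"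
    if "successively (\<lambda>x y. (x, y) \<in> E) xs" for xs
    using that
    by (induction "\<lambda>x y. (x, y) \<in> E" xs rule: successively.induct)
      (auto intro: converse_rtrancl_into_rtrancl)
  assume "w \<in> segment E u v"
  then obtain xs where "directed_path E u xs v" "w \<in> set xs" by (auto simp: segment_def)
  then show "(u, w) \<in> E\<^sup>* \<and> (w, v) \<in> E\<^sup>*"
    using reach[of xs] by (auto simp: directed_path_def)
next
  have extend: "directed_path E u (xs @ [z]) z" if "directed_path E u xs y" "(y, z) \<in> E" for xs y z
    using that by (auto simp: directed_path_def successively_append_iff)
  assume "(u, w) \<in> E\<^sup>* \<and> (w, v) \<in> E\<^sup>*"
  then have uw: "(u, w) \<in> E\<^sup>*" and wv: "(w, v) \<in> E\<^sup>*" by auto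
  from uw have "\<exists>xs. directed_path E u xs w"
  proof induction
    case base
    have "directed_path E u [u] u" by (simp add: directed_path_def)
    then show ?case by blast
  qed (blast intro: extend)
  then have start: "\<exists>xs. directed_path E u xs w \<and> w \<in> set xs"
    by (metis directed_path_def last_in_set)
  from wv have "\<exists>xs. directed_path E u xs v \<and> w \<in> set xs"
  proof induction
    case (step y z)
    then obtain xs where xs: "directed_path E u xs y" "w \<in> set xs" by blast
    then have "w \<in> set (xs @ [z])" by simp
    with extend[OF xs(1) step(2)] show ?case by blast
  qed (rule start)
  then show "w \<in> segment E u v" by (auto simp: segment_def)
qed

lemma rtrancl_ext_edges_iff:
  "(Some y, Some x) \<in> (ext_edges V E)\<^sup>* \<longleftrightarrow> (y, x) \<in> E\<^sup>*"
proof
  have "\<forall>x. z = Some x \<longrightarrow> (y, x) \<in> E\<^sup>*" if "(Some y, z) \<in> (ext_edges V E)\<^sup>*" for z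
    using that by induction (auto simp: ext_edges_def intro: rtrancl_into_rtrancl)
  then show "(Some y, Some x) \<in> (ext_edges V E)\<^sup>* \<Longrightarrow> (y, x) \<in> E\<^sup>*" by blast
  show "(y, x) \<in> E\<^sup>* \<Longrightarrow> (Some y, Some x) \<in> (ext_edges V E)\<^sup>*"
    by (induction rule: rtrancl_induct) (auto simp: ext_edges_def intro: rtrancl_into_rtrancl)
qed

lemma join_Some:
  "join V E (Some x) (Some y) =
     (if (y, x) \<in> E\<^sup>* then Some x else if (x, y) \<in> E\<^sup>* then Some y else None)"
  by (simp add: join_def Des_iff rtrancl_ext_edges_iff)

context rooted_directed_tree
begin

lemma parent_unique: "(x, z) \<in> E \<Longrightarrow> (y, z) \<in> E \<Longrightarrow> x = y"
  using unique_parent[of z] edges_subset by blast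

lemma root_in_V: "root_of V E \<in> V" and root_no_parent: "(x, root_of V E) \<notin> E"
  using theI'[OF unique_root] unfolding root_of_def by auto

text \<open>Connectedness ignores orientation. The set of descendants of the root is nevertheless closed
  under passing to a parent: a directed path from the root to \<open>y\<close> can only enter \<open>y\<close> through the
  unique parent of \<open>y\<close>.\<close>

lemma root_reaches:
  assumes "v \<in> V"
  shows "(root_of V E, v) \<in> E\<^sup>*"
  using connected[OF root_in_V assms]
proof induction
  case (step y z)
  show ?case
  proof (cases "(y, z) \<in> E")
    case False
    then have zy: "(z, y) \<in> E" using step(2) by blast
    from step(3) show ?thesis
    proof (cases rule: rtranclE)
      case base
      with zy root_no_parent show ?thesis by blast
    next
      case (step x)
      with zy parent_unique show ?thesis by blast
    qed
  qed (use step(3) in \<open>rule rtrancl_into_rtrancl\<close>)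
qed simp

lemma depth_unique:
  "(root_of V E, v) \<in> E ^^ n \<Longrightarrow> (root_of V E, v) \<in> E ^^ m \<Longrightarrow> n = m"
proof (induction n arbitrary: v m)
  case 0
  then show ?case using root_no_parent by (cases m) auto
next
  case (Suc n)
  then obtain p where p: "(root_of V E, p) \<in> E ^^ n" "(p, v) \<in> E" by auto
  then obtain k where k: "m = Suc k" using Suc.prems(2) root_no_parent by (cases m) auto
  with Suc.prems(2) p(2) parent_unique have "(root_of V E, p) \<in> E ^^ k" by auto
  with Suc.IH p(1) k show ?case by blast
qed

lemma depth_eq: "(root_of V E, v) \<in> E ^^ n \<Longrightarrow> depth V E v = n"
  unfolding depth_def using depth_unique by (intro the_equality) blast+

lemma depth_strict_mono:
  assumes "x \<in> V" "(x, y) \<in> E\<^sup>*" "x \<noteq> y"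
  shows "depth V E x < depth V E y"
proof -
  obtain n where n: "(root_of V E, x) \<in> E ^^ n"
    using root_reaches[OF assms(1)] rtrancl_imp_relpow by blast
  obtain k where k: "(x, y) \<in> E ^^ k" using assms(2) rtrancl_imp_relpow by blast
  with assms(3) have "k > 0" by (cases k) auto
  have "(root_of V E, y) \<in> E ^^ (n + k)" using n k by (auto simp: relpow_add)
  with n \<open>k > 0\<close> show ?thesis by (simp add: depth_eq)
qed

text \<open>When \<open>x\<close> is an ancestor of \<open>y\<close>, the common ancestors are those of \<open>x\<close>, and strict
  monotonicity of depth makes \<open>x\<close> the only deepest one. Below, meets are taken only of two ancestors
  of \<open>b\<close>, which are always comparable.\<close>

lemma meet_comparable:
  assumes "x \<in> V" "(x, y) \<in> E\<^sup>*"
  shows "meet V E x y = x" and "meet V E y x = x"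
proof -
  have ca: "common_ancestors V E x y = {w \<in> V. (w, x) \<in> E\<^sup>*}"
    "common_ancestors V E y x = {w \<in> V. (w, x) \<in> E\<^sup>*}"
    using assms(2) by (auto simp: common_ancestors_def rtrancl_power[symmetric] intro: rtrancl_trans)
  have eq: "(THE w. w \<in> {w \<in> V. (w, x) \<in> E\<^sup>*} \<and>
      (\<forall>w' \<in> {w \<in> V. (w, x) \<in> E\<^sup>*}. depth V E w' \<le> depth V E w)) = x"
  proof (rule the_equality)
    show "x \<in> {w \<in> V. (w, x) \<in> E\<^sup>*} \<and>
      (\<forall>w' \<in> {w \<in> V. (w, x) \<in> E\<^sup>*}. depth V E w' \<le> depth V E x)"
      using assms(1) depth_strict_mono by (auto intro: order.strict_implies_order order.refl)
  qed (use assms(1) depth_strict_mono in fastforce)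
  show "meet V E x y = x" "meet V E y x = x" using eq by (simp_all add: meet_def ca)
qed

lemma ancestors_comparable:
  assumes "(x, z) \<in> E\<^sup>*" "(y, z) \<in> E\<^sup>*"
  shows "(x, y) \<in> E\<^sup>* \<or> (y, x) \<in> E\<^sup>*"
proof -
  have "single_valued (E\<inverse>)" using parent_unique by (auto simp: single_valued_def)
  from single_valued_confluent[OF this, of z x y] assms show ?thesis
    by (auto simp: rtrancl_converse)
qed

lemma finite_ancestors:
  assumes "v \<in> V"
  shows "finite {w. (w, v) \<in> E\<^sup>*}"
  using root_reaches[OF assms]
proof induction
  case base
  have "{w. (w, root_of V E) \<in> E\<^sup>*} \<subseteq> {root_of V E}"
    using root_no_parent by (auto elim: rtranclE)
  then show ?case by (rule finite_subset) simp
next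
  case (step y z)
  have "{w. (w, z) \<in> E\<^sup>*} \<subseteq> insert z {w. (w, y) \<in> E\<^sup>*}"
    using parent_unique[OF _ step(2)] by (auto elim: rtranclE)
  then show ?case by (rule finite_subset) (use step(3) in simp)
qed

lemma ancestor_in_V: "(w, v) \<in> E\<^sup>* \<Longrightarrow> v \<in> V \<Longrightarrow> w \<in> V"
  using edges_subset by (auto elim: converse_rtranclE)

section \<open>Fibres of the join at a base vertex\<close>

lemma A_set_eq:
  "A_set E u b = (if (u, b) \<in> E\<^sup>* then {w. (u, w) \<in> E\<^sup>* \<and> (w, b) \<in> E\<^sup>*}
     else insert b {w. (w, u) \<in> E\<^sup>*})"
  by (auto simp: A_set_def Des_iff segment_iff Asc_iff rtrancl_eq_or_trancl)

lemma in_A_set: "u \<in> A_set E u b"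
  by (simp add: A_set_eq)

lemma A_set_subset: "u \<in> V \<Longrightarrow> b \<in> V \<Longrightarrow> A_set E u b \<subseteq> V"
  using ancestor_in_V by (auto simp: A_set_eq)

lemma finite_A_set: "u \<in> V \<Longrightarrow> b \<in> V \<Longrightarrow> finite (A_set E u b)"
  using finite_ancestors by (auto simp: A_set_eq)

lemma join_at_base: "join_at V E b (Some b) (Some v) = Some v"
  using no_circuits by (auto simp: join_at_def Asc_iff acyclic_def)

text \<open>If \<open>b\<close> is a proper descendant of \<open>u\<close>, the vertices on the path from \<open>u\<close> to \<open>b\<close> are sent to
  \<open>u\<close> by the meet or, in the case of \<open>b\<close> itself, by the clause for the base vertex; the other
  ancestors of \<open>b\<close> lie above \<open>u\<close> and are fixed by the meet. The remaining vertices are not ancestors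
  of \<open>u\<close>, so the ordinary join cannot give \<open>u\<close>. If \<open>b\<close> is not a descendant of \<open>u\<close>, no
  meet occurs, \<open>b\<close> is again sent to \<open>u\<close> as the base vertex, and apart from \<open>b\<close> the ordinary join
  sends exactly the ancestors of \<open>u\<close> and \<open>u\<close> itself to \<open>u\<close>.\<close>

lemma join_at_cases:
  assumes "u \<in> V" "v \<in> V" "b \<noteq> u"
  shows "v \<in> A_set E u b \<Longrightarrow> join_at V E b (Some u) (Some v) = Some u"
    and "v \<notin> A_set E u b \<Longrightarrow> join_at V E b (Some u) (Some v) \<in> {Some v, None}"
proof -
  have at: "join_at V E b (Some u) (Some v) =
     (if (u, b) \<in> E\<^sup>+ \<and> (v, b) \<in> E\<^sup>+ then Some (meet V E u v)
      else if v = b then Some u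
      else if (v, u) \<in> E\<^sup>* then Some u else if (u, v) \<in> E\<^sup>* then Some v else None)"
    using assms(3) by (auto simp: join_at_def Asc_iff join_Some)
  show "join_at V E b (Some u) (Some v) = Some u" if v: "v \<in> A_set E u b"
  proof (cases "(u, b) \<in> E\<^sup>*")
    case True
    with v have "(u, v) \<in> E\<^sup>*" "(v, b) \<in> E\<^sup>*" by (auto simp: A_set_eq)
    moreover from True assms(3) have "(u, b) \<in> E\<^sup>+" by (auto simp: rtrancl_eq_or_trancl)
    ultimately show ?thesis
      unfolding at using meet_comparable(1)[OF assms(1)] by (auto simp: rtrancl_eq_or_trancl)
  next
    case False
    then have "(u, b) \<notin> E\<^sup>+" by (auto dest: trancl_into_rtrancl)
    with False v show ?thesis unfolding at by (auto simp: A_set_eq)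
  qed
  show "join_at V E b (Some u) (Some v) \<in> {Some v, None}" if v: "v \<notin> A_set E u b"
  proof (cases "(u, b) \<in> E\<^sup>*")
    case True
    with assms(3) have ub: "(u, b) \<in> E\<^sup>+" by (auto simp: rtrancl_eq_or_trancl)
    show ?thesis
    proof (cases "(v, b) \<in> E\<^sup>+")
      case vb: True
      with v True have "(u, v) \<notin> E\<^sup>*"
        by (auto simp: A_set_eq dest: trancl_into_rtrancl)
      moreover have "(u, v) \<in> E\<^sup>* \<or> (v, u) \<in> E\<^sup>*"
        using True vb by (intro ancestors_comparable) (auto intro: trancl_into_rtrancl)
      ultimately have "meet V E u v = v" using meet_comparable(2)[OF assms(2)] by blast
      with ub vb show ?thesis by (simp add: at)
    next
      case False
      then have "(v, u) \<notin> E\<^sup>*" using ub by (meson rtrancl_trancl_trancl)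
      moreover have "v \<noteq> b" using v True by (auto simp: A_set_eq)
      ultimately show ?thesis using False by (simp add: at)
    qed
  next
    case False
    then have "(u, b) \<notin> E\<^sup>+" by (auto dest: trancl_into_rtrancl)
    with False v show ?thesis by (auto simp: at A_set_eq)
  qed
qed

lemma weighted_join_op_base:
  "multiplication_op V (\<lambda>v. l (Some v)) (weighted_join_op V E b b l)"
proof -
  have "join_transform V E b b l f = (\<lambda>v. l (Some v) * f v)" if "f \<in> ell2 V" for f
  proof
    fix w
    have "{v \<in> V. v = w} = (if w \<in> V then {w} else {})" by auto
    then show "join_transform V E b b l f w = l (Some w) * f w"
      using that by (auto simp: join_transform_def join_at_base ell2_def)
  qed
  then show ?thesis by (auto simp: multiplication_op_def weighted_join_op_def)
qed

lemma weighted_join_op_row_perturbed: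
  assumes u: "u \<in> V" and b: "b \<in> V" and ne: "b \<noteq> u"
  shows "row_perturbed_diagonal V (A_set E u b) u (\<lambda>v. l (Some v))
    (\<lambda>w. if w \<notin> A_set E u b \<and> join_at V E b (Some u) (Some w) = Some w then l (Some w) else 0)
    (weighted_join_op V E b u l)" (is "row_perturbed_diagonal V ?A u ?c ?\<mu> ?W")
proof
  show "finite ?A" "?A \<subseteq> V" "u \<in> ?A"
    using finite_A_set A_set_subset in_A_set u b by auto
  note J = join_at_cases[OF u _ ne]
  fix f :: "'a \<Rightarrow> complex" assume f: "f \<in> ell2 V"
  show "op_app ?W f = (\<lambda>w. if w = u then \<Sum>v\<in>?A. ?c v * f v else ?\<mu> w * f w)"
  proof
    fix w
    have fibre_u: "{v \<in> V. join_at V E b (Some u) (Some v) = Some u} = ?A"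
      using J \<open>?A \<subseteq> V\<close> \<open>u \<in> ?A\<close> by fastforce
    have fibre: "{v \<in> V. join_at V E b (Some u) (Some v) = Some w} =
        (if w \<notin> ?A \<and> join_at V E b (Some u) (Some w) = Some w then {w} else {})"
      if "w \<in> V" "w \<noteq> u"
      using J that by fastforce
    show "op_app ?W f w = (if w = u then \<Sum>v\<in>?A. ?c v * f v else ?\<mu> w * f w)"
    proof (cases "w \<in> V")
      case True
      then show ?thesis
        using fibre \<open>finite ?A\<close>
        by (cases "w = u") (simp_all add: weighted_join_op_def join_transform_def fibre_u)
    next
      case False
      with f u show ?thesis by (auto simp: weighted_join_op_def join_transform_def ell2_def)
    qed
  qed
qed (auto simp: weighted_join_op_def)

end

theorem proposition5p3:
  fixes V :: "'a set" and E :: "('a \<times> 'a) set" and u b :: 'a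
    and l :: "'a option \<Rightarrow> complex"
  assumes "rooted_directed_tree V E"
    and "countable V" and "infinite V"
    and "u \<in> V" and "b \<in> V"
    and "l None = 0"
  defines "W \<equiv> weighted_join_op V E b u l"
  shows "(normal_op V W \<longleftrightarrow> hyponormal_op V W)
    \<and> (normal_op V W \<longleftrightarrow> cohyponormal_op V W)
    \<and> (normal_op V W \<longleftrightarrow> diagonal_wrt V basis_vec W)
    \<and> (normal_op V W \<longleftrightarrow> (b = u \<or> (\<forall>v \<in> A_set E u b - {u}. l (Some v) = 0)))"
proof -
  interpret rooted_directed_tree V E by fact
  let ?cond = "b = u \<or> (\<forall>v \<in> A_set E u b - {u}. l (Some v) = 0)"
  have "\<exists>\<mu>. multiplication_op V \<mu> W" if ?cond
  proof (cases "b = u")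
    case True
    then show ?thesis using weighted_join_op_base[of l b] by (auto simp: W_def)
  next
    case False
    then interpret R: row_perturbed_diagonal V "A_set E u b" u "\<lambda>v. l (Some v)"
      "\<lambda>w. if w \<notin> A_set E u b \<and> join_at V E b (Some u) (Some w) = Some w then l (Some w) else 0" W
      unfolding W_def using assms(4,5) by (rule weighted_join_op_row_perturbed[rotated 2])
    show ?thesis using R.multiplication_if_row_trivial that False by blast
  qed
  then have "?cond \<Longrightarrow> normal_op V W" "?cond \<Longrightarrow> cohyponormal_op V W"
    "?cond \<Longrightarrow> diagonal_wrt V basis_vec W"
    using multiplication_op_normal multiplication_op_cohyponormal multiplication_op_diagonal
    by blast+
  moreover have ?cond if "hyponormal_op V W \<or> cohyponormal_op V W \<or> diagonal_wrt V basis_vec W"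
  proof (cases "b = u")
    case False
    then interpret R: row_perturbed_diagonal V "A_set E u b" u "\<lambda>v. l (Some v)"
      "\<lambda>w. if w \<notin> A_set E u b \<and> join_at V E b (Some u) (Some w) = Some w then l (Some w) else 0" W
      unfolding W_def using assms(4,5) by (rule weighted_join_op_row_perturbed[rotated 2])
    show ?thesis
      using that R.hyponormal_imp_row_trivial R.cohyponormal_imp_row_trivial
        R.diagonal_imp_row_trivial by blast
  qed simp
  ultimately show ?thesis using normal_imp_hyponormal by blast
qed

end
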